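(* Let $\mu$, $\hat\mu$, $\mathcal{P}_h$, $Y_n$ be as described in the context and suppose that (B1)–(B3) of the context hold. Then for any $p>0$, $$\mathbb{E}\Big[\sup_{n=0,\dots,M}|Y_n|^p\Big]<+\infty.$$
   Context: Notation: $a\vee b=\max\{a,b\}$; $T\in(0,\infty)$; $W=(W_t)_{t\ge0}$ is a standard Brownian motion on a complete filtered probability space satisfying the usual conditions. A fractional Laurent polynomial (FLP) is a function $q:(0,\infty)\to\mathbb{R}$ of the form $q(x)=\sum_{n=e_1}^{e_2}a_nx^{s_n}$ with integers $e_1\le e_2$, $a_n\in\mathbb{R}$, and pairwise distinct exponents $s_n\in\mathbb{R}$. Standing assumptions: $\mu:(0,\infty)\to\mathbb{R}$ is an FLP satisfying, for some $L_0>0$, $(\mu(x)-\mu(y))(x-y)\le L_0|x-y|^2$ for all $x,y>0$; $\sigma\neq0$ and $c_{-1}>0$ are constants; $\hat\mu(x)=\mu(x)-c_{-1}x^{-1}$. Scheme: $M\in\mathbb{N}$, $h=T/M\in(0,1]$, $t_n=nh$, $\Delta W_n=W_{t_{n+1}}-W_{t_n}$, $\mathcal{P}_h:(0,\infty)\to(0,\infty)$ is a map, $Y_0=X_0>0$ is a deterministic initial value, and $Y_{n+1}$ is the unique positive solution of $$Y_{n+1}=\mathcal{P}_h(Y_n)+c_{-1}hY_{n+1}^{-1}+\hat\mu(\mathcal{P}_h(Y_n))h+\sigma\Delta W_n,\quad n=0,\dots,M-1.$$ Assumptions: (B1) There is $L>0$ with $(\hat\mu(x)-\hat\mu(y))(x-y)\le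 L|x-y|^2$ for all $x,y>0$. (B2) $|\mathcal{P}_h(x)-\mathcal{P}_h(y)|\le|x-y|$ for all $x,y>0$, and there are constants $m_1,m_2\ge0$ and $C>0$ independent of $h$ such that $|\mathcal{P}_h(x)-x|\le Ch^2(1+|x|^{-m_1}+|x|^{m_2})$ for all $x>0$. (B3) There is $C>0$ independent of $h$ such that for all $x,y>0$: $|\hat\mu(\mathcal{P}_h(x))|\le Ch^{-1/2}\vee C|x|$ and $|\hat\mu(\mathcal{P}_h(x))-\hat\mu(\mathcal{P}_h(y))|\le Ch^{-1/2}|x-y|$. *)

theory Defs
  imports "HOL-Probability.Probability"
begin

text \<open>
  Functions on the half-line \<open>(0,\<infinity>)\<close> are represented by total functions on \<open>real\<close>
  whose values are only ever constrained (and used) at positive arguments; likewise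
  families indexed by \<open>t \<ge> 0\<close>.
\<close>

subsection \<open>Filtrations and Brownian motion\<close>

definition usual_conditions :: "'a measure \<Rightarrow> (real \<Rightarrow> 'a measure) \<Rightarrow> bool" where
  "usual_conditions M F \<longleftrightarrow>
     (\<forall>t\<ge>0. subalgebra M (F t)) \<and>
     (\<forall>s t. 0 \<le> s \<longrightarrow> s \<le> t \<longrightarrow> sets (F s) \<subseteq> sets (F t)) \<and>
     (\<forall>t\<ge>0. (\<Inter>s\<in>{t<..}. sets (F s)) = sets (F t)) \<and>
     null_sets M \<subseteq> sets (F 0)"

definition complete_filtered_prob_space :: "'a measure \<Rightarrow> (real \<Rightarrow> 'a measure) \<Rightarrow> bool" where
  "complete_filtered_prob_space M F \<longleftrightarrow>
     prob_space M \<and> complete_measure M \<and> usual_conditions M F"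

text \<open>
  Standard Brownian motion relative to the filtration \<open>F\<close>. The second parameter of
  \<^const>\<open>normal_density\<close> is the standard deviation, so the increment over \<open>[s,t]\<close> has
  variance \<open>t - s\<close>.
\<close>

definition standard_brownian_motion ::
  "'a measure \<Rightarrow> (real \<Rightarrow> 'a measure) \<Rightarrow> (real \<Rightarrow> 'a \<Rightarrow> real) \<Rightarrow> bool" where
  "standard_brownian_motion M F W \<longleftrightarrow>
     (\<forall>t\<ge>0. W t \<in> borel_measurable (F t)) \<and>
     (AE \<omega> in M. W 0 \<omega> = 0) \<and>
     (AE \<omega> in M. continuous_on {0..} (\<lambda>t. W t \<omega>)) \<and>
     (\<forall>s t. 0 \<le> s \<longrightarrow> s < t \<longrightarrow>
        distributed M lborel (\<lambda>\<omega>. W t \<omega> - W s \<omega>) (normal_density 0 (sqrt (t - s))) \<and>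
        prob_space.indep_set M (sets (F s))
          {(\<lambda>\<omega>. W t \<omega> - W s \<omega>) -` B \<inter> space M | B. B \<in> sets borel})"

subsection \<open>Coefficients\<close>

definition fractional_laurent_polynomial :: "(real \<Rightarrow> real) \<Rightarrow> bool" where
  "fractional_laurent_polynomial q \<longleftrightarrow>
     (\<exists>(e1::int) (e2::int) (a :: int \<Rightarrow> real) (s :: int \<Rightarrow> real).
        e1 \<le> e2 \<and> inj_on s {e1..e2} \<and>
        (\<forall>x>0. q x = (\<Sum>n = e1..e2. a n * x powr s n)))"

definition one_sided_lipschitz :: "(real \<Rightarrow> real) \<Rightarrow> bool" where
  "one_sided_lipschitz q \<longleftrightarrow>
     (\<exists>L>0. \<forall>x>0. \<forall>y>0. (q x - q y) * (x - y) \<le> L * \<bar>x - y\<bar>\<^sup>2)"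

definition mu_hat :: "(real \<Rightarrow> real) \<Rightarrow> real \<Rightarrow> real \<Rightarrow> real" where
  "mu_hat \<mu> c x = \<mu> x - c * inverse x"

subsection \<open>The scheme\<close>

text \<open>The value \<open>M = 0\<close> is excluded by \<open>0 < h\<close>, since \<open>T / 0 = 0\<close>.\<close>

definition step_sizes :: "real \<Rightarrow> real set" where
  "step_sizes T = {h. 0 < h \<and> h \<le> 1 \<and> (\<exists>M::nat. h = T / real M)}"

primrec scheme ::
  "(real \<Rightarrow> real) \<Rightarrow> real \<Rightarrow> real \<Rightarrow> (real \<Rightarrow> real) \<Rightarrow> real \<Rightarrow> (real \<Rightarrow> 'a \<Rightarrow> real) \<Rightarrow> real
     \<Rightarrow> nat \<Rightarrow> 'a \<Rightarrow> real" where
  "scheme \<mu> c \<sigma> P h W x0 0 \<omega> = x0"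
| "scheme \<mu> c \<sigma> P h W x0 (Suc n) \<omega> =
     (THE y. 0 < y \<and>
        y = P (scheme \<mu> c \<sigma> P h W x0 n \<omega>) + c * h * inverse y
            + mu_hat \<mu> c (P (scheme \<mu> c \<sigma> P h W x0 n \<omega>)) * h
            + \<sigma> * (W (real (Suc n) * h) \<omega> - W (real n * h) \<omega>))"

text \<open>The implicit equation does have exactly one positive solution, so \<open>THE\<close> is meaningful.\<close>

lemma ex1_positive_solution:
  fixes a k :: real
  assumes "k > 0"
  shows "\<exists>!y. 0 < y \<and> y = a + k * inverse y"
proof (rule ex_ex1I)
  define y where "y = (a + sqrt (a\<^sup>2 + 4 * k)) / 2"
  have "\<bar>a\<bar> < sqrt (a\<^sup>2 + 4 * k)"
    using assms by (intro real_less_rsqrt) simp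
  then have pos: "0 < y" by (simp add: y_def)
  have "y * y = a * y + k"
    using assms by (simp add: y_def field_simps power2_eq_square)
  then have "y = a + k * inverse y"
    using pos by (simp add: field_simps)
  with pos show "\<exists>y. 0 < y \<and> y = a + k * inverse y" by blast
next
  fix y z
  assume y: "0 < y \<and> y = a + k * inverse y" and z: "0 < z \<and> z = a + k * inverse z"
  show "y = z"
  proof (rule linorder_cases[of y z])
    assume "y < z"
    then have "k * inverse z < k * inverse y" using y assms by simp
    with y z \<open>y < z\<close> show ?thesis by linarith
  next
    assume "z < y"
    then have "k * inverse y < k * inverse z" using z assms by simp
    with y z \<open>z < y\<close> show ?thesis by linarith
  qed
qed

subsection \<open>Assumptions on the scheme\<close>

text \<open>
  \<open>P h\<close> is the map \<open>\<P>\<^sub>h\<close>. All constants are quantified before \<open>h\<close>, i.e. they do not depend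
  on the step size.
\<close>

definition assumption_B1 :: "(real \<Rightarrow> real) \<Rightarrow> real \<Rightarrow> bool" where
  "assumption_B1 \<mu> c \<longleftrightarrow> one_sided_lipschitz (mu_hat \<mu> c)"

definition assumption_B2 :: "real \<Rightarrow> (real \<Rightarrow> real \<Rightarrow> real) \<Rightarrow> bool" where
  "assumption_B2 T P \<longleftrightarrow>
     (\<forall>h\<in>step_sizes T. \<forall>x>0. \<forall>y>0. \<bar>P h x - P h y\<bar> \<le> \<bar>x - y\<bar>) \<and>
     (\<exists>m1\<ge>0. \<exists>m2\<ge>0. \<exists>C>0. \<forall>h\<in>step_sizes T. \<forall>x>0.
        \<bar>P h x - x\<bar> \<le> C * h\<^sup>2 * (1 + \<bar>x\<bar> powr (- m1) + \<bar>x\<bar> powr m2))"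

definition assumption_B3 ::
  "(real \<Rightarrow> real) \<Rightarrow> real \<Rightarrow> real \<Rightarrow> (real \<Rightarrow> real \<Rightarrow> real) \<Rightarrow> bool" where
  "assumption_B3 \<mu> c T P \<longleftrightarrow>
     (\<exists>C>0. \<forall>h\<in>step_sizes T. \<forall>x>0. \<forall>y>0.
        \<bar>mu_hat \<mu> c (P h x)\<bar> \<le> max (C * h powr (- 1/2)) (C * \<bar>x\<bar>) \<and>
        \<bar>mu_hat \<mu> c (P h x) - mu_hat \<mu> c (P h y)\<bar> \<le> C * h powr (- 1/2) * \<bar>x - y\<bar>)"

end

theory Submission
  imports Defs
begin

text \<open>
  The step size is fixed here, so a crude bound suffices. \<open>\<P>\<^sub>h\<close> is 1-Lipschitz and
  \<open>mu_hat \<mu> c \<circ> \<P>\<^sub>h\<close> grows at most linearly; since the positive solution of \<open>y = a + k / y\<close>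
  is at most \<open>\<bar>a\<bar> + \<surd>k\<close>, we get \<open>Y\<^sub>n\<^sub>+\<^sub>1 \<le> A Y\<^sub>n + B + \<bar>\<sigma> \<Delta>W\<^sub>n\<bar>\<close>. Gaussian increments have
  moments of all orders, hence by induction so has every \<open>Y\<^sub>n\<close>, and the supremum is over
  finitely many indices.
\<close>

text \<open>Natural exponents suit sums and Gaussian moments; real exponents are recovered in
  \<open>all_moments_integrable_powr\<close>. Measurability is listed separately because integrable
  powers of the absolute value do not give it for \<open>X\<close> itself. The case
  \<open>k = 0\<close> forces the measure to be finite.\<close>

definition all_moments :: "'a measure \<Rightarrow> ('a \<Rightarrow> real) \<Rightarrow> bool" where
  "all_moments M X \<longleftrightarrow>
     X \<in> borel_measurable M \<and> (\<forall>k::nat. integrable M (\<lambda>\<omega>. \<bar>X \<omega>\<bar> ^ k))"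

lemma all_moments_measurable: "all_moments M X \<Longrightarrow> X \<in> borel_measurable M"
  by (simp add: all_moments_def)

lemma all_moments_const: "finite_measure M \<Longrightarrow> all_moments M (\<lambda>_. a)"
  by (simp add: all_moments_def finite_measure.integrable_const)

lemma all_moments_cmult: "all_moments M X \<Longrightarrow> all_moments M (\<lambda>\<omega>. a * X \<omega>)"
  by (auto simp: all_moments_def abs_mult power_mult_distrib)

text \<open>The sum is at most twice the larger absolute value, and the k-th power of the larger one
  is one of the two summands on the right.\<close>

lemma abs_add_power_le:
  fixes x y :: real
  shows "\<bar>x + y\<bar> ^ k \<le> 2 ^ k * (\<bar>x\<bar> ^ k + \<bar>y\<bar> ^ k)"
proof -
  have "\<bar>x + y\<bar> ^ k \<le> (2 * max \<bar>x\<bar> \<bar>y\<bar>) ^ k"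
    by (intro power_mono) auto
  also have "\<dots> = 2 ^ k * max \<bar>x\<bar> \<bar>y\<bar> ^ k"
    by (simp add: power_mult_distrib)
  also have "\<dots> \<le> 2 ^ k * (\<bar>x\<bar> ^ k + \<bar>y\<bar> ^ k)"
    by (intro mult_left_mono) (auto simp: max_def)
  finally show ?thesis .
qed

lemma all_moments_add:
  assumes "all_moments M X" "all_moments M Y"
  shows "all_moments M (\<lambda>\<omega>. X \<omega> + Y \<omega>)"
  unfolding all_moments_def
proof (intro conjI allI)
  note [measurable] = assms[THEN all_moments_measurable]
  show "(\<lambda>\<omega>. X \<omega> + Y \<omega>) \<in> borel_measurable M" by measurable
  fix k :: nat
  have "integrable M (\<lambda>\<omega>. 2 ^ k * (\<bar>X \<omega>\<bar> ^ k + \<bar>Y \<omega>\<bar> ^ k))"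
    using assms by (auto simp: all_moments_def)
  then show "integrable M (\<lambda>\<omega>. \<bar>X \<omega> + Y \<omega>\<bar> ^ k)"
    by (rule Bochner_Integration.integrable_bound)
      (use abs_add_power_le in \<open>auto simp: power_abs[symmetric]\<close>)
qed

text \<open>This carries moments through the nonlinear implicit step: a linear majorant has them by
  the closure rules above, and powers are monotone on nonnegative reals.\<close>

lemma all_moments_dominated:
  assumes "all_moments M X" "Y \<in> borel_measurable M"
    and "\<And>\<omega>. \<omega> \<in> space M \<Longrightarrow> \<bar>Y \<omega>\<bar> \<le> \<bar>X \<omega>\<bar>"
  shows "all_moments M Y"
  unfolding all_moments_def
proof (intro conjI allI)
  note [measurable] = assms(2)
  show "Y \<in> borel_measurable M" by fact
  fix k :: nat
  have "integrable M (\<lambda>\<omega>. \<bar>X \<omega>\<bar> ^ k)"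
    using assms(1) by (simp add: all_moments_def)
  then show "integrable M (\<lambda>\<omega>. \<bar>Y \<omega>\<bar> ^ k)"
    by (rule Bochner_Integration.integrable_bound) (auto intro!: power_mono assms(3) AE_I2)
qed

lemma all_moments_abs: "all_moments M X \<Longrightarrow> all_moments M (\<lambda>\<omega>. \<bar>X \<omega>\<bar>)"
  by (rule all_moments_dominated) (auto dest: all_moments_measurable)

lemma all_moments_normal:
  assumes "distributed M lborel X (normal_density 0 s)" "0 < s"
  shows "all_moments M X"
  unfolding all_moments_def
proof (intro conjI allI)
  show "X \<in> borel_measurable M"
    using distributed_measurable[OF assms(1)] by simp
  fix k :: nat
  have "integrable lborel (\<lambda>x. normal_density 0 s x * \<bar>x\<bar> ^ k)"
    using integrable_normal_moment_abs[OF assms(2), of 0 k] by simp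
  then show "integrable M (\<lambda>\<omega>. \<bar>X \<omega>\<bar> ^ k)"
    by (subst (asm) distributed_integrable[OF assms(1), of "\<lambda>x. \<bar>x\<bar> ^ k"])
      (auto simp: normal_density_nonneg)
qed

text \<open>Round \<open>p\<close> up to an integer \<open>k\<close>. The power is at most 1 on
  [-1,1] and at most the k-th power outside, and the constant 1 is integrable because the measure is
  finite.\<close>

lemma (in finite_measure) all_moments_integrable_powr:
  assumes "all_moments M X" "0 \<le> p"
  shows "integrable M (\<lambda>\<omega>. \<bar>X \<omega>\<bar> powr p)"
proof -
  note [measurable] = all_moments_measurable[OF assms(1)]
  define k where "k = nat \<lceil>p\<rceil>"
  have pk: "p \<le> real k" unfolding k_def by linarith
  have bound: "\<bar>x\<bar> powr p \<le> 1 + \<bar>x\<bar> ^ k" for x :: real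
  proof (cases "\<bar>x\<bar> \<le> 1")
    case True
    then have "\<bar>x\<bar> powr p \<le> 1" using assms(2) by (intro powr_le1) auto
    then show ?thesis by (smt (verit) zero_le_power abs_ge_zero)
  next
    case False
    then have "\<bar>x\<bar> powr p \<le> \<bar>x\<bar> powr real k" using pk by (intro powr_mono) auto
    then show ?thesis using False by (simp add: powr_realpow)
  qed
  have "integrable M (\<lambda>\<omega>. 1 + \<bar>X \<omega>\<bar> ^ k)"
    using assms(1) by (auto simp: all_moments_def)
  then show ?thesis
    by (rule Bochner_Integration.integrable_bound) (use bound in \<open>auto simp: power_abs[symmetric]\<close>)
qed

text \<open>A finite supremum is attained, so the sum of the absolute values dominates it whatever
  the signs. Nonemptiness matters because the real supremum of the empty set is unspecified.\<close>

lemma integrable_cSUP: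
  fixes f :: "'i \<Rightarrow> 'a \<Rightarrow> real"
  assumes "finite I" "I \<noteq> {}" "\<And>i. i \<in> I \<Longrightarrow> integrable M (f i)"
  shows "integrable M (\<lambda>\<omega>. SUP i\<in>I. f i \<omega>)"
proof (rule Bochner_Integration.integrable_bound)
  show "integrable M (\<lambda>\<omega>. \<Sum>i\<in>I. \<bar>f i \<omega>\<bar>)" using assms by auto
  show "(\<lambda>\<omega>. SUP i\<in>I. f i \<omega>) \<in> borel_measurable M"
    using assms by (intro borel_measurable_cSUP) (auto intro: countable_finite)
  show "AE \<omega> in M. norm (SUP i\<in>I. f i \<omega>) \<le> norm (\<Sum>i\<in>I. \<bar>f i \<omega>\<bar>)"
  proof (intro AE_I2)
    fix \<omega>
    have "(SUP i\<in>I. f i \<omega>) = Max ((\<lambda>i. f i \<omega>) ` I)"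
      using assms by (intro cSup_eq_Max) auto
    also have "\<dots> \<in> (\<lambda>i. f i \<omega>) ` I" using assms by (intro Max_in) auto
    finally obtain i where i: "i \<in> I" "(SUP i\<in>I. f i \<omega>) = f i \<omega>" by auto
    have "\<bar>f i \<omega>\<bar> \<le> (\<Sum>i\<in>I. \<bar>f i \<omega>\<bar>)"
      using assms(1) i(1) by (intro member_le_sum) auto
    then show "norm (SUP i\<in>I. f i \<omega>) \<le> norm (\<Sum>i\<in>I. \<bar>f i \<omega>\<bar>)"
      using i(2) by simp
  qed
qed

text \<open>Multiplying by \<open>y\<close> gives the quadratic \<open>y * y = a * y + k\<close>,
  whose larger root is positive. The closed form replaces \<open>THE\<close> by a continuous
  function of \<open>a\<close>, from which measurability and growth can be read off.\<close>

lemma the_positive_solution: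
  fixes a k :: real
  assumes "0 < k"
  shows "(THE y. 0 < y \<and> y = a + k * inverse y) = (a + sqrt (a\<^sup>2 + 4 * k)) / 2"
proof (rule the1_equality[OF ex1_positive_solution[OF assms]])
  have "\<bar>a\<bar> < sqrt (a\<^sup>2 + 4 * k)"
    using assms by (intro real_less_rsqrt) simp
  moreover define y where "y = (a + sqrt (a\<^sup>2 + 4 * k)) / 2"
  ultimately have pos: "0 < y" by simp
  have "y * y = a * y + k"
    using assms by (simp add: y_def field_simps power2_eq_square)
  then have "y = a + k * inverse y"
    using pos by (simp add: field_simps)
  with pos show "0 < (a + sqrt (a\<^sup>2 + 4 * k)) / 2 \<and>
      (a + sqrt (a\<^sup>2 + 4 * k)) / 2 = a + k * inverse ((a + sqrt (a\<^sup>2 + 4 * k)) / 2)"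
    unfolding y_def by blast
qed

text \<open>The root exceeds the absolute value of \<open>a\<close>, which gives positivity even for
  negative \<open>a\<close>; subadditivity of the square root gives the upper bound.\<close>

lemma positive_solution_bounds:
  fixes a k :: real
  assumes "0 < k"
  shows "0 < (a + sqrt (a\<^sup>2 + 4 * k)) / 2" "(a + sqrt (a\<^sup>2 + 4 * k)) / 2 \<le> \<bar>a\<bar> + sqrt k"
proof -
  have "\<bar>a\<bar> < sqrt (a\<^sup>2 + 4 * k)"
    using assms by (intro real_less_rsqrt) simp
  then show "0 < (a + sqrt (a\<^sup>2 + 4 * k)) / 2" by simp
  have "sqrt (a\<^sup>2 + 4 * k) \<le> \<bar>a\<bar> + 2 * sqrt k"
    using assms sqrt_add_le_add_sqrt[of "a\<^sup>2" "4 * k"] by (simp add: real_sqrt_mult)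
  then show "(a + sqrt (a\<^sup>2 + 4 * k)) / 2 \<le> \<bar>a\<bar> + sqrt k" by simp
qed

lemma continuous_on_lipschitz:
  fixes f :: "real \<Rightarrow> real"
  assumes "\<And>x y. x \<in> S \<Longrightarrow> y \<in> S \<Longrightarrow> \<bar>f x - f y\<bar> \<le> L * \<bar>x - y\<bar>" "0 \<le> L"
  shows "continuous_on S f"
  using assms by (intro lipschitz_on_continuous_on[of L] lipschitz_onI) (auto simp: dist_real_def)

text \<open>The coefficients are controlled only on the positive half-line. Cutting \<open>f\<close>
  off by the indicator of \<open>S\<close> yields a Borel function on the whole line that agrees
  with \<open>f\<close> at all values of \<open>X\<close>.\<close>

lemma measurable_comp_continuous_on:
  fixes f :: "real \<Rightarrow> real"
  assumes "continuous_on S f" "S \<in> sets borel" "X \<in> borel_measurable M"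
    and "\<And>\<omega>. X \<omega> \<in> S"
  shows "(\<lambda>\<omega>. f (X \<omega>)) \<in> borel_measurable M"
proof -
  note [measurable] = assms(3) borel_measurable_continuous_on_indicator[OF assms(2,1)]
  have "(\<lambda>\<omega>. indicator S (X \<omega>) *\<^sub>R f (X \<omega>)) \<in> borel_measurable M" by measurable
  then show ?thesis using assms(4) by simp
qed

theorem lemma3p7:
  fixes \<Omega> :: "'a measure" and F :: "real \<Rightarrow> 'a measure" and W :: "real \<Rightarrow> 'a \<Rightarrow> real"
    and \<mu> :: "real \<Rightarrow> real" and P :: "real \<Rightarrow> real \<Rightarrow> real"
    and T c \<sigma> x0 p :: real and M :: nat
  assumes "complete_filtered_prob_space \<Omega> F"
    and "standard_brownian_motion \<Omega> F W"
    and "0 < T"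
    and "fractional_laurent_polynomial \<mu>"
    and "one_sided_lipschitz \<mu>"
    and "\<sigma> \<noteq> 0" and "0 < c" and "0 < x0"
    and "\<And>h x. h \<in> step_sizes T \<Longrightarrow> 0 < x \<Longrightarrow> 0 < P h x"
    and "assumption_B1 \<mu> c"
    and "assumption_B2 T P"
    and "assumption_B3 \<mu> c T P"
    and "T / real M \<in> step_sizes T"
    and "0 < p"
  shows "integrable \<Omega>
    (\<lambda>\<omega>. SUP n\<in>{0..M}. \<bar>scheme \<mu> c \<sigma> (P (T / real M)) (T / real M) W x0 n \<omega>\<bar> powr p)"
proof -
  define h where "h = T / real M"
  have hs: "h \<in> step_sizes T" unfolding h_def by fact
  then have h: "0 < h" by (simp add: step_sizes_def)
  interpret prob_space \<Omega>
    using assms(1) by (simp add: complete_filtered_prob_space_def)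
  have lip: "\<bar>P h x - P h y\<bar> \<le> \<bar>x - y\<bar>" if "0 < x" "0 < y" for x y
    using assms(11) hs that unfolding assumption_B2_def by blast
  obtain C where C: "0 < C"
    and grow: "\<And>x. 0 < x \<Longrightarrow>
      \<bar>mu_hat \<mu> c (P h x)\<bar> \<le> max (C * h powr (- 1/2)) (C * \<bar>x\<bar>)"
    and lip': "\<And>x y. 0 < x \<Longrightarrow> 0 < y \<Longrightarrow>
      \<bar>mu_hat \<mu> c (P h x) - mu_hat \<mu> c (P h y)\<bar> \<le> C * h powr (- 1/2) * \<bar>x - y\<bar>"
    using assms(12) hs unfolding assumption_B3_def by blast
  \<comment> \<open>For fixed \<open>h\<close> this is a mere constant, so its blow-up as
    \<open>h\<close> tends to 0 does no harm.\<close>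
  define D where "D = C * h powr (- 1/2)"
  have D: "0 < D" using C h by (simp add: D_def)
  define Y where "Y = scheme \<mu> c \<sigma> (P h) h W x0"
  define dW where "dW n \<omega> = W (real (Suc n) * h) \<omega> - W (real n * h) \<omega>" for n \<omega>
  \<comment> \<open>The explicit part of the step; \<open>Y (Suc n)\<close> is then the positive
    root of \<open>y = a + k * inverse y\<close> with \<open>k = c * h\<close>.\<close>
  define a where "a n \<omega> = P h (Y n \<omega>) + mu_hat \<mu> c (P h (Y n \<omega>)) * h + \<sigma> * dW n \<omega>" for n \<omega>
  have ch: "0 < c * h" using h assms(7) by simp
  have Y_Suc: "Y (Suc n) \<omega> = (a n \<omega> + sqrt ((a n \<omega>)\<^sup>2 + 4 * (c * h))) / 2" for n \<omega>
    using the_positive_solution[OF ch, of "a n \<omega>"]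
    by (simp add: Y_def a_def dW_def algebra_simps)
  \<comment> \<open>Positivity holds for every outcome, not just almost surely, and gives access to
    bounds assumed only at positive arguments. A case split suffices, since the root is positive
    whatever \<open>a\<close> is.\<close>
  have pos: "0 < Y n \<omega>" for n \<omega>
  proof (cases n)
    case 0
    then show ?thesis using assms(8) by (simp add: Y_def)
  next
    case (Suc m)
    then show ?thesis using positive_solution_bounds(1)[OF ch] by (simp only: Y_Suc)
  qed
  have dW: "all_moments \<Omega> (dW n)" for n
  proof (rule all_moments_normal)
    have "real n * h < real (Suc n) * h" "0 \<le> real n * h" using h by auto
    then show "distributed \<Omega> lborel (dW n)
        (normal_density 0 (sqrt (real (Suc n) * h - real n * h)))"
      using assms(2) unfolding standard_brownian_motion_def dW_def by blast
    show "0 < sqrt (real (Suc n) * h - real n * h)" using h by (simp add: algebra_simps)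
  qed
  have "all_moments \<Omega> (Y n)" for n
  proof (induction n)
    case 0
    then show ?case by (simp add: Y_def all_moments_const finite_measure_axioms)
  next
    case (Suc n)
    note [measurable] = all_moments_measurable[OF Suc] all_moments_measurable[OF dW]
    have "continuous_on {0<..} (P h)"
      using lip by (intro continuous_on_lipschitz[of _ _ 1]) auto
    then have [measurable]: "(\<lambda>\<omega>. P h (Y n \<omega>)) \<in> borel_measurable \<Omega>"
      by (rule measurable_comp_continuous_on) (auto simp: pos)
    have "continuous_on {0<..} (\<lambda>x. mu_hat \<mu> c (P h x))"
      using lip' D unfolding D_def by (intro continuous_on_lipschitz[of _ _ "C * h powr (- 1/2)"]) auto
    then have [measurable]: "(\<lambda>\<omega>. mu_hat \<mu> c (P h (Y n \<omega>))) \<in> borel_measurable \<Omega>"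
      by (rule measurable_comp_continuous_on) (auto simp: pos)
    have [measurable]: "a n \<in> borel_measurable \<Omega>" unfolding a_def by measurable
    \<comment> \<open>\<open>1 + \<bar>P h 1\<bar>\<close> comes from comparing \<open>P h\<close>
      with its value at the reference point 1, \<open>D * h\<close> from the constant part of the
      drift bound, and \<open>sqrt (c * h)\<close> from the implicit term.\<close>
    define B where "B = 1 + \<bar>P h 1\<bar> + D * h + sqrt (c * h)"
    have "all_moments \<Omega> (\<lambda>\<omega>. (1 + C * h) * Y n \<omega> + B + \<bar>\<sigma>\<bar> * \<bar>dW n \<omega>\<bar>)"
      by (intro all_moments_add all_moments_cmult all_moments_abs all_moments_const
          Suc dW finite_measure_axioms)
    then show ?case
    proof (rule all_moments_dominated)
      show "Y (Suc n) \<in> borel_measurable \<Omega>" unfolding Y_Suc by measurable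
      fix \<omega>
      have "\<bar>P h (Y n \<omega>)\<bar> \<le> \<bar>P h 1\<bar> + 1 + Y n \<omega>"
        using lip[OF pos[of n \<omega>], of 1] pos[of n \<omega>] by linarith
      moreover have "\<bar>mu_hat \<mu> c (P h (Y n \<omega>)) * h\<bar> \<le> D * h + C * h * Y n \<omega>"
      proof -
        \<comment> \<open>The maximum of two nonnegative numbers is at most their sum.\<close>
        have "\<bar>mu_hat \<mu> c (P h (Y n \<omega>))\<bar> \<le> D + C * Y n \<omega>"
          using grow[OF pos[of n \<omega>]] pos[of n \<omega>] C D
          unfolding D_def[symmetric] by (smt (verit) mult_pos_pos)
        from mult_right_mono[OF this, of h] show ?thesis
          using h by (simp add: abs_mult algebra_simps)
      qed
      moreover have "Y (Suc n) \<omega> \<le> \<bar>a n \<omega>\<bar> + sqrt (c * h)"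
        unfolding Y_Suc by (rule positive_solution_bounds(2)[OF ch])
      moreover have "\<bar>a n \<omega>\<bar> \<le> \<bar>P h (Y n \<omega>)\<bar> + \<bar>mu_hat \<mu> c (P h (Y n \<omega>)) * h\<bar> + \<bar>\<sigma>\<bar> * \<bar>dW n \<omega>\<bar>"
        unfolding a_def abs_mult[symmetric] by linarith
      ultimately have "Y (Suc n) \<omega> \<le> (1 + C * h) * Y n \<omega> + B + \<bar>\<sigma>\<bar> * \<bar>dW n \<omega>\<bar>"
        unfolding B_def by (simp add: algebra_simps)
      \<comment> \<open>By positivity of \<open>Y (Suc n)\<close> the upper bound alone controls its
        absolute value.\<close>
      then show "\<bar>Y (Suc n) \<omega>\<bar> \<le> \<bar>(1 + C * h) * Y n \<omega> + B + \<bar>\<sigma>\<bar> * \<bar>dW n \<omega>\<bar>\<bar>"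
        using pos[of "Suc n" \<omega>] by linarith
    qed
  qed
  \<comment> \<open>Only here does the real exponent \<open>p\<close> enter; the index set is finite
    and contains 0.\<close>
  then have "integrable \<Omega> (\<lambda>\<omega>. SUP n\<in>{0..M}. \<bar>Y n \<omega>\<bar> powr p)"
    using assms(14) by (intro integrable_cSUP all_moments_integrable_powr) auto
  then show ?thesis unfolding Y_def h_def .
qed

end
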